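(* Consider the Deffuant model on $\mathbb{Z}$ with measure-valued opinions, convergence parameter $\mu\in(0,\tfrac12]$, and total variation distance as the distance between two opinions, in which the initial opinions $\{\eta_0(v)\}_{v\in\mathbb{Z}}$ are independently assigned random symmetric triangular distributions: for each $v\in\mathbb{Z}$, $\eta_0(v)$ is the probability measure on $[0,1]$ with Lebesgue density $f_{U(v)}$, where $\{U(v)\}_{v\in\mathbb{Z}}$ are i.i.d. uniform on $[0,1]^2$ and $$f_{(y,z)}(x)=\frac{2}{|y-z|}\Big(1-\frac{2}{|y-z|}\Big|x-\frac{y+z}{2}\Big|\Big)^+,\quad x\in[0,1].$$ Then for every confidence bound $\theta\in[0,1)$, the system almost surely approaches disagreement, i.e. almost surely there exists an edge $\langle u,u+1\rangle$ and a time $T<\infty$ such that $\lVert\eta_t(u)-\eta_t(u+1)\rVert_{\mathrm{TV}}>\theta$ for all $t\ge T$.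
   Context: Notation: $x^+=\max\{x,0\}$. The total variation distance of probability measures is $\lVert\nu_1-\nu_2\rVert_{\mathrm{TV}}=\sup_A|\nu_1(A)-\nu_2(A)|$; for densities $f,g$ on $[0,1]$ it equals $\frac12\int_0^1|f(x)-g(x)|\,dx$. (The event $y=z$ has probability $0$ and is ignored.) Deffuant model on $\mathbb{Z}$ (measure-valued opinions): the graph has vertex set $\mathbb{Z}$ and edges $\langle v,v+1\rangle$, $v\in\mathbb{Z}$. Parameters: confidence bound $\theta$ and convergence parameter $\mu\in(0,\tfrac12]$. At time $t\ge0$ each vertex $v$ holds an opinion $\eta_t(v)$, an absolutely continuous probability measure on $[0,1]$. The initial opinions $\{\eta_0(v)\}_{v\in\mathbb{Z}}$ are i.i.d. Independently of them, the edges carry i.i.d. homogeneous Poisson processes of a common positive rate. When a Poisson event occurs at time $t$ on edge $\langle u,v\rangle$, and the opinions just before are $a=\eta_{t-}(u)$, $b=\eta_{t-}(v)$, then: if $\lVert a-b\rVert_{\mathrm{TV}}\le\theta$, set $\eta_t(u)=(1-\mu)a+\mu b$ and $\eta_t(v)=(1-\mu)b+\mu a$; otherwise both opinions stay unchanged. Opinions change in no other way. Almost surely this is well defined for all times, since for each fixed $t$ there are a.s. infinitely many edges to the left and to the right of any vertex without Poisson event up to time $t$. *)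

theory Defs
  imports "HOL-Probability.Probability"
begin

abbreviation unit_lborel :: "real measure" where
  "unit_lborel \<equiv> restrict_space lborel {0..1}"

definition opinion :: "real measure \<Rightarrow> bool" where
  "opinion \<nu> \<longleftrightarrow> prob_space \<nu> \<and> sets \<nu> = sets unit_lborel \<and> absolutely_continuous unit_lborel \<nu>"

text \<open>Both definitions below are meant for measures on a common sigma-algebra.\<close>

definition tv_dist :: "'a measure \<Rightarrow> 'a measure \<Rightarrow> real" where
  "tv_dist a b = (SUP A\<in>sets a. \<bar>measure a A - measure b A\<bar>)"

definition mix :: "real \<Rightarrow> 'a measure \<Rightarrow> 'a measure \<Rightarrow> 'a measure" where
  "mix \<mu> a b = measure_of (space a) (sets a)
     (\<lambda>A. ennreal (1 - \<mu>) * emeasure a A + ennreal \<mu> * emeasure b A)"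

lemma space_mix [simp]: "space (mix \<mu> a b) = space a"
  and sets_mix [simp]: "sets (mix \<mu> a b) = sets a"
  by (simp_all add: mix_def)

lemma emeasure_mix:
  assumes "sets b = sets a" "A \<in> sets a"
  shows "emeasure (mix \<mu> a b) A = ennreal (1 - \<mu>) * emeasure a A + ennreal \<mu> * emeasure b A"
proof (rule emeasure_measure_of[OF mix_def])
  show "sets a \<subseteq> Pow (space a)" by (rule sets.space_closed)
  show "A \<in> sets (mix \<mu> a b)" using assms by simp
  show "positive (sets (mix \<mu> a b))
      (\<lambda>A. ennreal (1 - \<mu>) * emeasure a A + ennreal \<mu> * emeasure b A)"
    by (simp add: positive_def)
  show "countably_additive (sets (mix \<mu> a b))
      (\<lambda>A. ennreal (1 - \<mu>) * emeasure a A + ennreal \<mu> * emeasure b A)"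
  proof (rule countably_additiveI)
    fix F :: "nat \<Rightarrow> 'a set"
    assume F: "range F \<subseteq> sets (mix \<mu> a b)" "disjoint_family F"
    then have "(\<Sum>i. emeasure a (F i)) = emeasure a (\<Union>i. F i)"
      and "(\<Sum>i. emeasure b (F i)) = emeasure b (\<Union>i. F i)"
      using assms by (auto intro!: suminf_emeasure)
    then show "(\<Sum>i. ennreal (1 - \<mu>) * emeasure a (F i) + ennreal \<mu> * emeasure b (F i)) =
        ennreal (1 - \<mu>) * emeasure a (\<Union>i. F i) + ennreal \<mu> * emeasure b (\<Union>i. F i)"
      by (simp add: suminf_add[symmetric] ennreal_suminf_cmult)
  qed
qed

text \<open>The edge between \<open>e\<close> and \<open>e + 1\<close> is represented by \<open>e\<close>, and \<open>C e\<close> is the set of its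
  event times. The values \<open>a\<close>, \<open>b\<close> are the left limits at the event time; paths are piecewise
  constant in time, so the left limit is the value taken on some interval just before.\<close>

definition deffuant_path ::
    "real \<Rightarrow> real \<Rightarrow> (int \<Rightarrow> real set) \<Rightarrow> (real \<Rightarrow> int \<Rightarrow> real measure) \<Rightarrow> bool" where
  "deffuant_path \<theta> \<mu> C x \<longleftrightarrow>
     (\<forall>t\<ge>0. \<forall>v. opinion (x t v)) \<and>
     (\<forall>e. \<forall>t\<in>C e. \<forall>a b. (\<forall>\<^sub>F s in at_left t. x s e = a \<and> x s (e + 1) = b) \<longrightarrow>
        (if tv_dist a b \<le> \<theta>
         then x t e = mix \<mu> a b \<and> x t (e + 1) = mix \<mu> b a
         else x t e = a \<and> x t (e + 1) = b)) \<and>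
     (\<forall>v s t. 0 \<le> s \<longrightarrow> s < t \<longrightarrow> (C (v - 1) \<union> C v) \<inter> {s<..t} = {} \<longrightarrow> x t v = x s v)"

text \<open>A homogeneous Poisson process on the positive half-line, given by its random set of points.\<close>

definition (in prob_space) poisson_process :: "real \<Rightarrow> ('a \<Rightarrow> real set) \<Rightarrow> bool" where
  "poisson_process r E \<longleftrightarrow>
     (AE \<omega> in M. E \<omega> \<subseteq> {0<..} \<and> (\<forall>t. finite (E \<omega> \<inter> {0<..t}))) \<and>
     (\<forall>s t. 0 \<le> s \<longrightarrow> s < t \<longrightarrow>
        (\<lambda>\<omega>. card (E \<omega> \<inter> {s<..t})) \<in> measurable M (count_space UNIV) \<and>
        distr M (count_space UNIV) (\<lambda>\<omega>. card (E \<omega> \<inter> {s<..t}))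
          = measure_pmf (poisson_pmf (r * (t - s)))) \<and>
     (\<forall>\<tau>::nat \<Rightarrow> real. 0 \<le> \<tau> 0 \<longrightarrow> mono \<tau> \<longrightarrow>
        indep_vars (\<lambda>_. count_space UNIV) (\<lambda>i \<omega>. card (E \<omega> \<inter> {\<tau> i<..\<tau> (Suc i)})) UNIV)"

text \<open>For independence, a clock \<open>C e\<close> is identified with its counting process.\<close>

locale deffuant_model = prob_space M for M :: "'w measure" +
  fixes \<theta> \<mu> r :: real
    and C :: "int \<Rightarrow> 'w \<Rightarrow> real set"
    and \<eta> :: "real \<Rightarrow> int \<Rightarrow> 'w \<Rightarrow> real measure"
  assumes convergence_parameter: "0 < \<mu>" "\<mu> \<le> 1 / 2"
    and rate_pos: "0 < r"
    and initial_indep: "indep_vars (\<lambda>_. prob_algebra unit_lborel) (\<eta> 0) UNIV"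
    and initial_ident:
      "\<And>v w. distr M (prob_algebra unit_lborel) (\<eta> 0 v) = distr M (prob_algebra unit_lborel) (\<eta> 0 w)"
    and clocks_poisson: "\<And>e. poisson_process r (C e)"
    and clocks_indep:
      "indep_vars (\<lambda>_. PiM UNIV (\<lambda>_. count_space UNIV)) (\<lambda>e \<omega> t. card (C e \<omega> \<inter> {0<..t})) UNIV"
    and initial_clocks_indep:
      "indep_set
         (sets (vimage_algebra (space M) (\<lambda>\<omega> v. \<eta> 0 v \<omega>) (PiM UNIV (\<lambda>_. prob_algebra unit_lborel))))
         (sets (vimage_algebra (space M) (\<lambda>\<omega> e t. card (C e \<omega> \<inter> {0<..t}))
            (PiM UNIV (\<lambda>_::int. PiM UNIV (\<lambda>_::real. count_space (UNIV::nat set))))))"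
    and dynamics: "AE \<omega> in M. deffuant_path \<theta> \<mu> (\<lambda>e. C e \<omega>) (\<lambda>t v. \<eta> t v \<omega>)"

definition triangular_density :: "real \<times> real \<Rightarrow> real \<Rightarrow> real" where
  "triangular_density = (\<lambda>(y, z) x.
     2 / \<bar>y - z\<bar> * max (1 - 2 / \<bar>y - z\<bar> * \<bar>x - (y + z) / 2\<bar>) 0)"

definition triangular_opinion :: "real \<times> real \<Rightarrow> real measure" where
  "triangular_opinion u = density unit_lborel (\<lambda>x. ennreal (triangular_density u x))"

end

theory Submission
  imports Defs
begin

text \<open>Fix a tiny interval \<open>A\<close> around \<open>1/2\<close>. With positive probability the triangle at a vertex
  \<open>v\<close> lives on \<open>A\<close>, while on both sides of \<open>v\<close> all averages of the initial masses
  \<open>\<eta>\<^sub>0(w)(A)\<close> over \<open>n\<close> consecutive vertices starting next to \<open>v\<close> are at most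
  \<open>\<delta> < 1 - \<theta>\<close>. Because \<open>\<mu> \<le> 1/2\<close>, updates preserve these bounds on averages. So at all times
  the neighbours of \<open>v\<close> give \<open>A\<close> mass at most \<open>\<delta>\<close>, which puts them at total variation distance at
  least \<open>1 - \<delta> > \<theta>\<close> from the opinion of \<open>v\<close>: that opinion never changes, and both edges at \<open>v\<close>
  stay blocked. Almost surely there are such vertices \<open>v\<close>.\<close>

subsection \<open>Dynamics next to a frozen vertex\<close>

lemma measure_mix:
  assumes "finite_measure a" "finite_measure b" "sets b = sets a" "A \<in> sets a" "0 \<le> \<mu>" "\<mu> \<le> 1"
  shows "measure (mix \<mu> a b) A = (1 - \<mu>) * measure a A + \<mu> * measure b A"
proof -
  interpret a: finite_measure a by fact
  interpret b: finite_measure b by fact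
  have "emeasure (mix \<mu> a b) A = ennreal ((1 - \<mu>) * measure a A + \<mu> * measure b A)"
    using assms by (simp add: emeasure_mix a.emeasure_eq_measure b.emeasure_eq_measure
        ennreal_mult ennreal_plus)
  then show ?thesis
    using assms by (intro measure_eq_emeasure_eq_ennreal) auto
qed

lemma measure_diff_le_tv_dist:
  assumes "prob_space a" "prob_space b" "A \<in> sets a"
  shows "\<bar>measure a A - measure b A\<bar> \<le> tv_dist a b"
proof -
  interpret a: prob_space a by fact
  interpret b: prob_space b by fact
  have "\<bar>measure a B - measure b B\<bar> \<le> 1" for B
    using a.prob_le_1[of B] b.prob_le_1[of B] measure_nonneg[of a B] measure_nonneg[of b B]
    by linarith
  then have "bdd_above ((\<lambda>A. \<bar>measure a A - measure b A\<bar>) ` sets a)"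
    by (intro bdd_aboveI[of _ 1]) auto
  then show ?thesis
    unfolding tv_dist_def using assms(3) by (intro cSUP_upper)
qed

text \<open>Only the prefix sum ending between the two exchanged entries changes, and for
  \<open>c \<le> 1/2\<close> its new value is a convex combination of itself and the two adjacent prefix sums.\<close>

lemma prefix_sums_exchange:
  fixes f g :: "nat \<Rightarrow> real"
  assumes bound: "\<And>n. n \<le> N \<Longrightarrow> (\<Sum>k<n. f k) \<le> d * real n"
    and c: "0 \<le> c" "c \<le> 1 / 2"
    and i: "Suc i < N"
    and g_i: "g i = (1 - c) * f i + c * f (Suc i)"
    and g_Suc_i: "g (Suc i) = (1 - c) * f (Suc i) + c * f i"
    and g_other: "\<And>k. k < N \<Longrightarrow> k \<noteq> i \<Longrightarrow> k \<noteq> Suc i \<Longrightarrow> g k = f k"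
    and n: "n \<le> N"
  shows "(\<Sum>k<n. g k) \<le> d * real n"
proof -
  have shift: "(\<Sum>k<n. g k) = (\<Sum>k<n. f k) + (if n = Suc i then c * (f (Suc i) - f i) else 0)"
    using n
  proof (induction n)
    case (Suc n)
    then show ?case
      using g_other[of n] by (cases "n = i"; cases "n = Suc i") (auto simp: g_i g_Suc_i algebra_simps)
  qed simp
  show ?thesis
  proof (cases "n = Suc i")
    case True
    let ?S = "\<lambda>n. \<Sum>k<n. f k"
    have "(\<Sum>k<n. g k) = (1 - 2 * c) * ?S (Suc i) + c * ?S i + c * ?S (Suc (Suc i))"
      using shift True by (simp add: algebra_simps)
    also have "\<dots> \<le> (1 - 2 * c) * (d * real (Suc i)) + c * (d * real i) + c * (d * real (Suc (Suc i)))"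
      using c i by (intro add_mono mult_left_mono bound) auto
    also have "\<dots> = d * real n"
      using True by (simp add: algebra_simps)
    finally show ?thesis .
  next
    case False
    then show ?thesis using shift bound[OF n] by simp
  qed
qed

lemma deffuant_path_opinion:
  assumes "deffuant_path \<theta> \<mu> C x" "0 \<le> t"
  shows "opinion (x t v)"
  using assms by (simp add: deffuant_path_def)

lemma deffuant_path_constant:
  assumes "deffuant_path \<theta> \<mu> C x" "0 \<le> s" "s \<le> t" "(C (v - 1) \<union> C v) \<inter> {s<..t} = {}"
  shows "x t v = x s v"
  using assms by (cases "s = t") (auto simp: deffuant_path_def)

lemma deffuant_path_update:
  assumes path: "deffuant_path \<theta> \<mu> C x" and \<mu>: "0 \<le> \<mu>" "\<mu> \<le> 1"
    and s: "0 \<le> s" "s < m" and m: "m \<in> C e"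
    and quiet: "\<And>f. f \<in> {e - 1, e, e + 1} \<Longrightarrow> C f \<inter> {s<..<m} = {}"
    and A: "A \<in> sets unit_lborel"
  obtains c where "c = 0 \<or> c = \<mu> \<and> tv_dist (x s e) (x s (e + 1)) \<le> \<theta>"
    "measure (x m e) A = (1 - c) * measure (x s e) A + c * measure (x s (e + 1)) A"
    "measure (x m (e + 1)) A = (1 - c) * measure (x s (e + 1)) A + c * measure (x s e) A"
proof -
  have eq: "x s' w = x s w" if "w = e \<or> w = e + 1" "s < s'" "s' < m" for s' w
  proof -
    have "C (w - 1) \<inter> {s<..<m} = {}" "C w \<inter> {s<..<m} = {}"
      using that(1) by (auto intro!: quiet)
    then have "(C (w - 1) \<union> C w) \<inter> {s<..s'} = {}"
      using that by fastforce
    then show ?thesis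
      using path s that by (intro deffuant_path_constant) auto
  qed
  have "\<forall>\<^sub>F s' in at_left m. x s' e = x s e \<and> x s' (e + 1) = x s (e + 1)"
    using eventually_at_left_real[OF s(2)] by eventually_elim (auto simp: eq)
  then have upd: "if tv_dist (x s e) (x s (e + 1)) \<le> \<theta>
      then x m e = mix \<mu> (x s e) (x s (e + 1)) \<and> x m (e + 1) = mix \<mu> (x s (e + 1)) (x s e)
      else x m e = x s e \<and> x m (e + 1) = x s (e + 1)"
    using path m unfolding deffuant_path_def by blast
  have op: "opinion (x s e)" "opinion (x s (e + 1))"
    using path s by (auto intro: deffuant_path_opinion)
  show thesis
  proof (cases "tv_dist (x s e) (x s (e + 1)) \<le> \<theta>")
    case True
    have "finite_measure (x s e)" "finite_measure (x s (e + 1))"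
      "sets (x s e) = sets unit_lborel" "sets (x s (e + 1)) = sets unit_lborel"
      using op by (auto simp: opinion_def prob_space.finite_measure)
    with True upd \<mu> A show thesis
      by (intro that[of \<mu>]) (auto simp: measure_mix)
  next
    case False
    with upd show thesis by (intro that[of 0]) auto
  qed
qed

text \<open>Up to a finite time, two silent edges cut out a finite segment around \<open>v\<close>
  with finitely many events, which can be processed one by one. The bounds of length one keep both
  edges at \<open>v\<close> blocked, so exchanges happen only on either side of \<open>v\<close>,
  where \<open>prefix_sums_exchange\<close> preserves all bounds.\<close>

lemma deffuant_path_frozen:
  fixes v :: int and C :: "int \<Rightarrow> real set" and x :: "real \<Rightarrow> int \<Rightarrow> real measure"
  assumes path: "deffuant_path \<theta> \<mu> C x" and \<mu>: "0 \<le> \<mu>" "\<mu> \<le> 1 / 2"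
    and C_finite: "\<And>e t. finite (C e \<inter> {0<..t})"
    and C_disjoint: "\<And>e f t. e \<noteq> f \<Longrightarrow> 0 < t \<Longrightarrow> t \<in> C e \<Longrightarrow> t \<notin> C f"
    and gap_right: "\<And>w n. \<exists>e\<ge>w. C e \<inter> {0<..real n} = {}"
    and gap_left: "\<And>w n. \<exists>e\<le>w. C e \<inter> {0<..real n} = {}"
    and A: "A \<in> sets unit_lborel" and \<delta>: "\<delta> < 1 - \<theta>"
    and centre: "measure (x 0 v) A = 1"
    and right: "\<And>n. (\<Sum>k<n. measure (x 0 (v + 1 + int k)) A) \<le> \<delta> * real n"
    and left: "\<And>n. (\<Sum>k<n. measure (x 0 (v - 1 - int k)) A) \<le> \<delta> * real n"
    and t: "0 \<le> t"
  shows "\<theta> < tv_dist (x t v) (x t (v + 1))"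
proof -
  obtain n where n: "t \<le> real n" using real_arch_simple by blast
  define T where "T = real n"
  \<comment> \<open>\<open>L\<close> and \<open>R\<close> isolate the vertices \<open>L + 1\<close>,
    ..., \<open>R\<close> until time \<open>T\<close>. The inequalities put \<open>v\<close> and
    both its neighbours among them.\<close>
  obtain R where R: "v + 1 \<le> R" "C R \<inter> {0<..T} = {}" using gap_right T_def by blast
  obtain L where L: "L \<le> v - 2" "C L \<inter> {0<..T} = {}" using gap_left T_def by blast
  define F where "F = (\<Union>e\<in>{L..R}. C e) \<inter> {0<..T}"
  have "F = (\<Union>e\<in>{L..R}. C e \<inter> {0<..T})" by (auto simp: F_def)
  moreover have "finite \<dots>" using C_finite by (intro finite_UN_I) auto
  ultimately have finF: "finite F" by simp
  let ?y = "\<lambda>t w. measure (x t w) A"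
  \<comment> \<open>The lengths \<open>nat (R - v)\<close> and \<open>nat (v - 1 - L)\<close> are
    the numbers of vertices of the segment to the right and to the left of \<open>v\<close>.\<close>
  define P where "P t \<longleftrightarrow> ?y t v = 1
      \<and> (\<forall>n\<le>nat (R - v). (\<Sum>k<n. ?y t (v + 1 + int k)) \<le> \<delta> * real n)
      \<and> (\<forall>n\<le>nat (v - 1 - L). (\<Sum>k<n. ?y t (v - 1 - int k)) \<le> \<delta> * real n)" for t
  have P_cong: "P t" if "P s" "\<And>w. L < w \<Longrightarrow> w \<le> R \<Longrightarrow> ?y t w = ?y s w" for s t
  proof -
    have "(\<Sum>k<n. ?y t (v + 1 + int k)) = (\<Sum>k<n. ?y s (v + 1 + int k))" if "n \<le> nat (R - v)" for n
      using that L R \<open>\<And>w. L < w \<Longrightarrow> w \<le> R \<Longrightarrow> ?y t w = ?y s w\<close> by (intro sum.cong) auto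
    moreover have "(\<Sum>k<n. ?y t (v - 1 - int k)) = (\<Sum>k<n. ?y s (v - 1 - int k))"
      if "n \<le> nat (v - 1 - L)" for n
      using that L R \<open>\<And>w. L < w \<Longrightarrow> w \<le> R \<Longrightarrow> ?y t w = ?y s w\<close> by (intro sum.cong) auto
    moreover have "?y t v = ?y s v" using that L R by auto
    ultimately show ?thesis using that(1) by (simp add: P_def)
  qed
  have P_tv: "\<theta> < tv_dist (x t v) (x t (v + 1))" "\<theta> < tv_dist (x t (v - 1)) (x t v)"
    if "P t" "0 \<le> t" for t
  proof -
    have "\<forall>n\<le>nat (R - v). (\<Sum>k<n. ?y t (v + 1 + int k)) \<le> \<delta> * real n"
      "\<forall>n\<le>nat (v - 1 - L). (\<Sum>k<n. ?y t (v - 1 - int k)) \<le> \<delta> * real n"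
      and 1: "?y t v = 1"
      using that(1) by (auto simp: P_def)
    \<comment> \<open>Prefix sums of length one are the masses at the neighbours of
      \<open>v\<close>.\<close>
    from this(1)[rule_format, of 1] this(2)[rule_format, of 1]
    have le: "?y t (v + 1) \<le> \<delta>" "?y t (v - 1) \<le> \<delta>" using L R by auto
    have op: "prob_space (x t w)" "sets (x t w) = sets unit_lborel" for w
      using path that(2) deffuant_path_opinion opinion_def by blast+
    show "\<theta> < tv_dist (x t v) (x t (v + 1))"
      using measure_diff_le_tv_dist[OF op(1)[of v] op(1)[of "v + 1"], of A] A op(2) le 1 \<delta> by auto
    show "\<theta> < tv_dist (x t (v - 1)) (x t v)"
      using measure_diff_le_tv_dist[OF op(1)[of "v - 1"] op(1)[of v], of A] A op(2) le 1 \<delta> by auto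
  qed
  have const: "?y t w = ?y s w" if "0 \<le> s" "s \<le> t" "t \<le> T" "L < w" "w \<le> R" "F \<inter> {s<..t} = {}" for s t w
  proof -
    have "u \<notin> C (w - 1) \<union> C w" if "s < u" "u \<le> t" for u
    proof -
      have "u \<notin> F" "w - 1 \<in> {L..R}" "w \<in> {L..R}"
        using that \<open>F \<inter> {s<..t} = {}\<close> \<open>L < w\<close> \<open>w \<le> R\<close> by auto
      then show ?thesis using that \<open>0 \<le> s\<close> \<open>t \<le> T\<close> by (auto simp: F_def)
    qed
    then have "(C (w - 1) \<union> C w) \<inter> {s<..t} = {}" by auto
    then show ?thesis using deffuant_path_constant[OF path that(1,2), of w] by simp
  qed
  have "P t" if "0 \<le> t" "t \<le> T" for t
    using that
  \<comment> \<open>Induction on the number of events in the segment: the invariant at a time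
    \<open>s\<close> shortly before the last event \<open>m\<close> is carried across
    \<open>m\<close>, and nothing changes from \<open>m\<close> to \<open>t\<close>.\<close>
  proof (induction "card (F \<inter> {0<..t})" arbitrary: t rule: less_induct)
    case less
    show ?case
    proof (cases "F \<inter> {0<..t} = {}")
      case True
      have "P 0" using centre right left by (simp add: P_def)
      then show ?thesis using const[of 0 t] less.prems True by (intro P_cong[of 0 t]) auto
    next
      case False
      define m where "m = Max (F \<inter> {0<..t})"
      have m: "m \<in> F" "0 < m" "m \<le> t" using Max_in[OF _ False] finF by (auto simp: m_def)
      have above_m: "F \<inter> {m<..t} = {}"
      proof -
        have "u \<le> m" if "u \<in> F" "0 < u" "u \<le> t" for u using finF that by (auto simp: m_def)
        with m show ?thesis by fastforce
      qed
      \<comment> \<open>The last event before \<open>m\<close>, or 0 if there is none. With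
        \<open>s\<close> strictly between \<open>s0\<close> and \<open>m\<close>, no event falls
        between \<open>s\<close> and \<open>m\<close>, and \<open>m\<close> itself is not counted at
        \<open>s\<close>.\<close>
      define s0 where "s0 = Max (insert 0 (F \<inter> {0<..<m}))"
      have s0: "0 \<le> s0" "s0 < m" using finF m by (auto simp: s0_def)
      have s0_max: "u \<le> s0" if "u \<in> F" "0 < u" "u < m" for u
        using finF that by (auto simp: s0_def)
      define s where "s = (s0 + m) / 2"
      have s: "0 \<le> s" "s < m" "s0 < s" using s0 by (auto simp: s_def)
      have quiet: "u \<notin> F" if "s < u" "u < m" for u
        using s0_max[of u] that s by auto
      have "F \<inter> {0<..s} \<subseteq> F \<inter> {0<..t}" "m \<in> F \<inter> {0<..t}" "m \<notin> F \<inter> {0<..s}"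
        using m s by auto
      then have "F \<inter> {0<..s} \<subset> F \<inter> {0<..t}" by blast
      then have Ps: "P s" using less.hyps[of s] less.prems s m finF by (simp add: psubset_card_mono)
      obtain e where e: "L \<le> e" "e \<le> R" "m \<in> C e" using m by (auto simp: F_def)
      have mT: "m \<le> T" using m less.prems by simp
      \<comment> \<open>The boundary edges are silent up to \<open>T\<close>, so both endpoints of
        \<open>e\<close> lie in the segment.\<close>
      have "e \<noteq> L" "e \<noteq> R" using e L R m mT by auto
      then have e': "L < e" "e < R" using e by auto
      \<comment> \<open>Distinct edges never have simultaneous events, so only the endpoints of
        \<open>e\<close> can change at \<open>m\<close>.\<close>
      have other: "?y m w = ?y s w" if "L < w" "w \<le> R" "w \<noteq> e" "w \<noteq> e + 1" for w
      proof -
        have *: "m \<notin> C (w - 1)" "m \<notin> C w"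
          using C_disjoint[of e w m] C_disjoint[of e "w - 1" m] that e m by auto
        have "u \<notin> C (w - 1) \<union> C w" if u: "s < u" "u \<le> m" for u
        proof (cases "u = m")
          case False
          then have "u \<notin> F" using quiet u by auto
          moreover have "w - 1 \<in> {L..R}" "w \<in> {L..R}" using \<open>L < w\<close> \<open>w \<le> R\<close> by auto
          ultimately show ?thesis using s u mT by (auto simp: F_def)
        qed (use * in auto)
        then have "(C (w - 1) \<union> C w) \<inter> {s<..m} = {}" by auto
        then show ?thesis using deffuant_path_constant[OF path s(1), of m w] s by simp
      qed
      have quiet_e: "C f \<inter> {s<..<m} = {}" if "f \<in> {e - 1, e, e + 1}" for f
      proof -
        have "f \<in> {L..R}" using that e' by auto
        then have "u \<notin> C f" if "s < u" "u < m" for u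
          using quiet[OF that] that s mT by (auto simp: F_def)
        then show ?thesis by auto
      qed
      obtain c where c: "c = 0 \<or> c = \<mu> \<and> tv_dist (x s e) (x s (e + 1)) \<le> \<theta>"
        and ye: "?y m e = (1 - c) * ?y s e + c * ?y s (e + 1)"
        and ye': "?y m (e + 1) = (1 - c) * ?y s (e + 1) + c * ?y s e"
        by (rule deffuant_path_update[OF path \<mu>(1) _ s(1,2) e(3) quiet_e A]) (use \<mu> in auto)
      have c_bounds: "0 \<le> c" "c \<le> 1 / 2" using c \<mu> by auto
      have Ps_dest: "?y s v = 1"
        "\<And>n. n \<le> nat (R - v) \<Longrightarrow> (\<Sum>k<n. ?y s (v + 1 + int k)) \<le> \<delta> * real n"
        "\<And>n. n \<le> nat (v - 1 - L) \<Longrightarrow> (\<Sum>k<n. ?y s (v - 1 - int k)) \<le> \<delta> * real n"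
        using Ps by (auto simp: P_def)
      have "P m"
      proof -
        consider "e = v \<or> e = v - 1" | "v < e" | "e < v - 1" by linarith
        then show ?thesis
        proof cases
          case 1
          \<comment> \<open>The invariant keeps the distance across either edge at \<open>v\<close>
            above \<theta>, so this update is blocked.\<close>
          then have "c = 0" using c P_tv[OF Ps s(1)] by auto
          then have "?y m w = ?y s w" if "L < w" "w \<le> R" for w
            using other[of w] that ye ye' by auto
          then show ?thesis using P_cong[OF Ps] by blast
        next
          case 2
          define i where "i = nat (e - v - 1)"
          have i: "e = v + 1 + int i" "e + 1 = v + 1 + int (Suc i)" using 2 by (auto simp: i_def)
          have "(\<Sum>k<n. ?y m (v + 1 + int k)) \<le> \<delta> * real n" if "n \<le> nat (R - v)" for n
          proof (rule prefix_sums_exchange[OF Ps_dest(2) c_bounds _ _ _ _ that])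
            show "Suc i < nat (R - v)" using e' i by auto
            show "?y m (v + 1 + int i) = (1 - c) * ?y s (v + 1 + int i) + c * ?y s (v + 1 + int (Suc i))"
              using ye unfolding i(2) unfolding i(1) .
            show "?y m (v + 1 + int (Suc i)) = (1 - c) * ?y s (v + 1 + int (Suc i)) + c * ?y s (v + 1 + int i)"
              using ye' unfolding i(2) unfolding i(1) .
            show "?y m (v + 1 + int k) = ?y s (v + 1 + int k)"
              if "k < nat (R - v)" "k \<noteq> i" "k \<noteq> Suc i" for k
              using that i L R by (intro other) auto
          qed
          moreover have "(\<Sum>k<n. ?y m (v - 1 - int k)) = (\<Sum>k<n. ?y s (v - 1 - int k))"
            if "n \<le> nat (v - 1 - L)" for n
            using that 2 L R by (intro sum.cong other) auto
          moreover have "?y m v = ?y s v" using 2 L R by (intro other) auto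
          ultimately show ?thesis using Ps_dest by (auto simp: P_def)
        next
          case 3
          \<comment> \<open>On the left, indices count away from \<open>v\<close>, so
            \<open>e + 1\<close> precedes \<open>e\<close> in the sum.\<close>
          define i where "i = nat (v - 2 - e)"
          have i: "e = v - 1 - int (Suc i)" "e + 1 = v - 1 - int i" using 3 by (auto simp: i_def)
          have "(\<Sum>k<n. ?y m (v - 1 - int k)) \<le> \<delta> * real n" if "n \<le> nat (v - 1 - L)" for n
          proof (rule prefix_sums_exchange[OF Ps_dest(3) c_bounds _ _ _ _ that])
            show "Suc i < nat (v - 1 - L)" using e' i by auto
            show "?y m (v - 1 - int i) = (1 - c) * ?y s (v - 1 - int i) + c * ?y s (v - 1 - int (Suc i))"
              using ye' unfolding i(2) unfolding i(1) .
            show "?y m (v - 1 - int (Suc i)) = (1 - c) * ?y s (v - 1 - int (Suc i)) + c * ?y s (v - 1 - int i)"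
              using ye unfolding i(2) unfolding i(1) .
            show "?y m (v - 1 - int k) = ?y s (v - 1 - int k)"
              if "k < nat (v - 1 - L)" "k \<noteq> i" "k \<noteq> Suc i" for k
              using that i L R by (intro other) auto
          qed
          moreover have "(\<Sum>k<n. ?y m (v + 1 + int k)) = (\<Sum>k<n. ?y s (v + 1 + int k))"
            if "n \<le> nat (R - v)" for n
            using that 3 L R by (intro sum.cong other) auto
          moreover have "?y m v = ?y s v" using 3 L R by (intro other) auto
          ultimately show ?thesis using Ps_dest by (auto simp: P_def)
        qed
      qed
      then show ?thesis
        using const[of m t] m less.prems above_m by (intro P_cong[of m t]) auto
    qed
  qed
  then show ?thesis using P_tv(1)[of t] t n T_def by auto
qed

subsection \<open>Existence of a frozen vertex\<close>

text \<open>Both windows leave out \<open>v\<close>, so that for independent values the condition is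
  independent of the value at \<open>v\<close>. They start right next to \<open>v\<close>, as do the
  prefix sums in \<open>deffuant_path_frozen\<close>.\<close>

definition sparse_around :: "'b set \<Rightarrow> real \<Rightarrow> nat \<Rightarrow> (int \<Rightarrow> 'b) \<Rightarrow> int \<Rightarrow> bool" where
  "sparse_around W d n f v \<longleftrightarrow>
     real (card {k. k < n \<and> f (v + 1 + int k) \<in> W}) \<le> d * real n \<and>
     real (card {k. k < n \<and> f (v - 1 - int k) \<in> W}) \<le> d * real n"

lemma real_card_eq_sum_indicator:
  fixes n :: nat
  shows "real (card {k. k < n \<and> P k \<in> W}) = (\<Sum>k<n. indicator W (P k))"
proof -
  have "(\<Sum>k<n. indicator W (P k) :: real) = (\<Sum>k\<in>{k. k < n \<and> P k \<in> W}. 1)"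
    by (rule sum.mono_neutral_cong_right) (auto simp: indicator_def)
  then show ?thesis by simp
qed

lemma sparse_around_cong:
  assumes "\<And>w. v - int n \<le> w \<Longrightarrow> w \<le> v + int n \<Longrightarrow> w \<noteq> v \<Longrightarrow> f w = g w"
  shows "sparse_around W d n f v \<longleftrightarrow> sparse_around W d n g v"
proof -
  have "{k. k < n \<and> f (v + 1 + int k) \<in> W} = {k. k < n \<and> g (v + 1 + int k) \<in> W}"
    "{k. k < n \<and> f (v - 1 - int k) \<in> W} = {k. k < n \<and> g (v - 1 - int k) \<in> W}"
    using assms by (intro Collect_cong conj_cong refl; simp)+
  then show ?thesis by (simp add: sparse_around_def)
qed

text \<open>Measurability is asked only on the punctured window, since the lemma is also applied to
  coordinates of product spaces indexed by such a window.\<close>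

lemma sets_sparse_around:
  assumes "\<And>w. v - int n \<le> w \<Longrightarrow> w \<le> v + int n \<Longrightarrow> w \<noteq> v \<Longrightarrow> Y w \<in> measurable Q N" and [measurable]: "W \<in> sets N"
  shows "{x\<in>space Q. sparse_around W d n (\<lambda>w. Y w x) v} \<in> sets Q"
proof -
  have [measurable]: "(\<lambda>x. \<Sum>k<n. indicator W (Y (v + 1 + int k) x) :: real) \<in> borel_measurable Q"
    "(\<lambda>x. \<Sum>k<n. indicator W (Y (v - 1 - int k) x) :: real) \<in> borel_measurable Q"
    by (intro borel_measurable_sum measurable_compose[OF assms(1) borel_measurable_indicator]; simp)+
  show ?thesis
    unfolding sparse_around_def real_card_eq_sum_indicator by measurable
qed

section \<open>From small error probabilities to almost sure existence\<close>

context prob_space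
begin

text \<open>The set where \<open>P\<close> fails need not be measurable; it is contained in the
  intersection of all \<open>D n\<close>, which is a null event.\<close>

lemma AE_I_small:
  assumes "\<And>n. D n \<in> events" "\<And>n. prob (D n) \<le> e n" "e \<longlonglongrightarrow> 0"
    and "\<And>n \<omega>. \<omega> \<in> space M \<Longrightarrow> \<omega> \<notin> D n \<Longrightarrow> P \<omega>"
  shows "AE \<omega> in M. P \<omega>"
proof (rule AE_I)
  show "{\<omega>\<in>space M. \<not> P \<omega>} \<subseteq> (\<Inter>n::nat. D n)" using assms(4) by blast
  show "(\<Inter>n. D n) \<in> events" using assms(1) by auto
  have "prob (\<Inter>n. D n) \<le> e n" for n
    using finite_measure_mono[of "\<Inter>n. D n" "D n"] assms(1,2)[of n] by fastforce
  then have "prob (\<Inter>n. D n) \<le> 0" using assms(3) by (intro LIMSEQ_le_const) auto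
  then have "prob (\<Inter>n. D n) = 0" by (rule antisym) simp
  then show "emeasure M (\<Inter>n. D n) = 0" by (simp add: emeasure_eq_measure)
qed

text \<open>Union bound: if more than \<open>d * n\<close> indices hit \<open>W\<close>, they form
  one of at most \<open>2 ^ n\<close> index sets, and by independence all indices of such a set hit
  \<open>W\<close> with probability at most \<open>p powr (d * n)\<close>. The injection \<sigma>
  allows enumerating vertices in either direction.\<close>

lemma prob_frequent_le:
  assumes X: "indep_vars (\<lambda>_. N) X UNIV" and \<sigma>: "inj \<sigma>" and W: "W \<in> sets N"
    and p: "\<And>v. prob (X v -` W \<inter> space M) \<le> p" "0 < p" "p < 1" and d: "0 < d" and n: "0 < n"
  shows "prob {\<omega>\<in>space M. \<not> real (card {k. k < n \<and> X (\<sigma> k) \<omega> \<in> W}) \<le> d * real n}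
    \<le> (2 * p powr d) ^ n"
proof -
  define \<J> where "\<J> = {J. J \<subseteq> {..<n} \<and> d * real n < real (card J)}"
  have fin: "finite \<J>" by (rule finite_subset[of _ "Pow {..<n}"]) (auto simp: \<J>_def)
  have card_\<J>: "real (card \<J>) \<le> 2 ^ n"
  proof -
    have "card \<J> \<le> card (Pow {..<n})" by (intro card_mono) (auto simp: \<J>_def)
    then have "real (card \<J>) \<le> real (2 ^ n)" unfolding of_nat_le_iff by (simp add: card_Pow)
    then show ?thesis by simp
  qed
  define E where "E J = (\<Inter>v\<in>\<sigma> ` J. X v -` W \<inter> space M)" for J
  have X_meas: "X v \<in> measurable M N" for v using X by (auto simp: indep_vars_def)
  have J: "finite J" "J \<noteq> {}" "d * real n < real (card J)" if "J \<in> \<J>" for J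
  proof -
    \<comment> \<open>Positivity makes \<open>J\<close> nonempty, which the product formula for
      independent events asks for.\<close>
    have "0 < d * real n" using d n by simp
    then show "finite J" "J \<noteq> {}" "d * real n < real (card J)"
      using that by (auto simp: \<J>_def intro: finite_subset)
  qed
  have E_sets: "E J \<in> events" if "J \<in> \<J>" for J
    unfolding E_def using J[OF that] X_meas W by (intro sets.finite_INT) (auto intro: measurable_sets)
  have "prob (E J) \<le> (p powr d) ^ n" if "J \<in> \<J>" for J
  proof -
    have "prob (E J) = (\<Prod>v\<in>\<sigma> ` J. prob (X v -` W \<inter> space M))"
      unfolding E_def using J[OF that] W by (intro indep_varsD[OF X]) auto
    also have "\<dots> \<le> (\<Prod>v\<in>\<sigma> ` J. p)" by (intro prod_mono) (auto simp: p)
    also have "\<dots> = p powr real (card J)"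
      using \<sigma> p by (simp add: card_image inj_on_subset powr_realpow)
    also have "\<dots> \<le> p powr (d * real n)"
      using J[OF that] p by (intro powr_mono') auto
    also have "\<dots> = (p powr d) ^ n" using p by (simp add: powr_powr[symmetric] powr_realpow)
    finally show ?thesis .
  qed
  then have "(\<Sum>J\<in>\<J>. prob (E J)) \<le> real (card \<J>) * (p powr d) ^ n"
    by (intro sum_bounded_above) auto
  also have "\<dots> \<le> 2 ^ n * (p powr d) ^ n" using card_\<J> by (intro mult_right_mono) auto
  finally have *: "(\<Sum>J\<in>\<J>. prob (E J)) \<le> (2 * p powr d) ^ n" by (simp add: power_mult_distrib)
  have "prob {\<omega>\<in>space M. \<not> real (card {k. k < n \<and> X (\<sigma> k) \<omega> \<in> W}) \<le> d * real n} \<le> prob (\<Union>J\<in>\<J>. E J)"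
  proof (rule finite_measure_mono)
    show "{\<omega>\<in>space M. \<not> real (card {k. k < n \<and> X (\<sigma> k) \<omega> \<in> W}) \<le> d * real n} \<subseteq> (\<Union>J\<in>\<J>. E J)"
    proof
      fix \<omega> assume \<omega>: "\<omega> \<in> {\<omega>\<in>space M. \<not> real (card {k. k < n \<and> X (\<sigma> k) \<omega> \<in> W}) \<le> d * real n}"
      define J where "J = {k. k < n \<and> X (\<sigma> k) \<omega> \<in> W}"
      have "J \<in> \<J>" using \<omega> by (auto simp: \<J>_def J_def)
      moreover have "\<omega> \<in> E J" using \<omega> J(2)[OF \<open>J \<in> \<J>\<close>] by (auto simp: E_def J_def)
      ultimately show "\<omega> \<in> (\<Union>J\<in>\<J>. E J)" by blast
    qed
    show "(\<Union>J\<in>\<J>. E J) \<in> events" using fin E_sets by auto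
  qed
  also have "\<dots> \<le> (\<Sum>J\<in>\<J>. prob (E J))" using fin E_sets by (intro measure_UNION_le)
  finally show ?thesis using * by linarith
qed

text \<open>Windows of radius \<open>K\<close> around the multiples of \<open>2 * K + 1\<close> are disjoint, so the truncated
  events are independent with probability at least \<open>g / 3\<close>, while for large \<open>K\<close> the truncation
  error of the first \<open>K\<close> of them is of order \<open>K / 4 ^ K\<close>.\<close>

lemma AE_exists_sparse_around:
  fixes X :: "int \<Rightarrow> 'a \<Rightarrow> 'b"
  assumes X: "indep_vars (\<lambda>_. N) X UNIV" and W: "W \<in> sets N" and G: "G \<in> sets N"
    and p: "\<And>v. prob (X v -` W \<inter> space M) \<le> p" "0 < p" "p < 1" and d: "0 < d"
    and p_d: "2 * p powr d \<le> 1 / 4"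
    and g: "\<And>v. g \<le> prob (X v -` G \<inter> space M)" "0 < g"
  shows "AE \<omega> in M. \<exists>v. X v \<omega> \<in> G \<and> (\<forall>n. sparse_around W d n (\<lambda>w. X w \<omega>) v)"
proof -
  have X_meas: "X v \<in> measurable M N" for v using X by (auto simp: indep_vars_def)
  have X_space: "X v \<omega> \<in> space N" if "\<omega> \<in> space M" for v \<omega>
    using measurable_space[OF X_meas that] .
  define bad where "bad v n = {\<omega>\<in>space M. \<not> sparse_around W d n (\<lambda>w. X w \<omega>) v}" for v n
  have bad_sets: "bad v n \<in> events" for v n
    unfolding bad_def using sets_sparse_around[of v n X M N W d] X_meas W
    by (intro sets.sets_Collect_neg) auto
  have frequent_sets: "{\<omega>\<in>space M. \<not> real (card {k. k < n \<and> X (\<sigma> k) \<omega> \<in> W}) \<le> d * real n} \<in> events"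
    for n and \<sigma> :: "nat \<Rightarrow> int"
  proof -
    note W[measurable]
    have [measurable]: "(\<lambda>\<omega>. \<Sum>k<n. indicator W (X (\<sigma> k) \<omega>) :: real) \<in> borel_measurable M"
      by (intro borel_measurable_sum measurable_compose[OF X_meas borel_measurable_indicator]) simp
    show ?thesis unfolding real_card_eq_sum_indicator by measurable
  qed
  have bad_le: "prob (bad v n) \<le> 2 * (1 / 4) ^ n" if "0 < n" for v n
  proof -
    define R where "R = {\<omega>\<in>space M. \<not> real (card {k. k < n \<and> X (v + 1 + int k) \<omega> \<in> W}) \<le> d * real n}"
    define L where "L = {\<omega>\<in>space M. \<not> real (card {k. k < n \<and> X (v - 1 - int k) \<omega> \<in> W}) \<le> d * real n}"
    have meas: "R \<in> events" "L \<in> events"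
      unfolding R_def L_def by (rule frequent_sets)+
    have inj: "inj (\<lambda>k. v + 1 + int k)" "inj (\<lambda>k. v - 1 - int k)" by (auto simp: inj_def)
    have "prob R \<le> (2 * p powr d) ^ n"
      unfolding R_def by (rule prob_frequent_le[OF X inj(1) W p d that])
    moreover have "prob L \<le> (2 * p powr d) ^ n"
      unfolding L_def by (rule prob_frequent_le[OF X inj(2) W p d that])
    moreover have "(2 * p powr d) ^ n \<le> (1 / 4) ^ n" using p_d by (intro power_mono) auto
    moreover have "bad v n = R \<union> L"
      unfolding bad_def sparse_around_def R_def L_def by blast
    moreover have "prob (R \<union> L) \<le> prob R + prob L" using meas by (rule measure_Un_le)
    ultimately show ?thesis by simp
  qed
  define H where "H v K = {\<omega>\<in>space M. \<forall>n\<in>{..K}. sparse_around W d n (\<lambda>w. X w \<omega>) v}" for v K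
  define B where "B v K = (X v -` G \<inter> space M) \<inter> H v K" for v K
  have B_ge: "g / 3 \<le> prob (B v K)" for v K
  proof -
    have "H v K = space M - (\<Union>n\<in>{1..K}. bad v n)"
    proof -
      \<comment> \<open>For \<open>n = 0\<close> the condition holds trivially. Leaving it out makes
        the union bound effective: from \<open>n = 1\<close> on, the errors
        \<open>2 * (1 / 4) ^ n\<close> sum to at most \<open>2 / 3\<close>.\<close>
      have "{..K} = insert 0 {1..K}" by auto
      then have "(\<forall>n\<in>{..K}. P n) \<longleftrightarrow> P 0 \<and> (\<forall>n\<in>{1..K}. P n)" for P by simp
      then have "H v K = {\<omega>\<in>space M. \<forall>n\<in>{1..K}. sparse_around W d n (\<lambda>w. X w \<omega>) v}"
        by (simp add: H_def sparse_around_def)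
      then show ?thesis unfolding bad_def by blast
    qed
    moreover have "(\<Union>n\<in>{1..K}. bad v n) \<in> events" using bad_sets by blast
    ultimately have "prob (H v K) = 1 - prob (\<Union>n\<in>{1..K}. bad v n)"
      using prob_compl by metis
    moreover have "prob (\<Union>n\<in>{1..K}. bad v n) \<le> (\<Sum>n\<in>{1..K}. prob (bad v n))"
      using bad_sets by (intro measure_UNION_le) auto
    moreover have "(\<Sum>n\<in>{1..K}. prob (bad v n)) \<le> (\<Sum>n\<in>{1..K}. 2 * (1 / 4) ^ n)"
      by (intro sum_mono bad_le) auto
    moreover have "(\<Sum>n\<in>{1..K}. 2 * (1 / 4) ^ n) \<le> (2 / 3 :: real)"
    proof -
      have "(\<Sum>n\<in>{1..K}. 2 * (1 / 4) ^ n) = 2 / 3 - 2 / 3 * (1 / 4 :: real) ^ K"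
        by (induction K) auto
      then show ?thesis by simp
    qed
    ultimately have H: "1 / 3 \<le> prob (H v K)" by linarith
    \<comment> \<open>\<open>bool\<close> indexes two disjoint blocks, the vertex \<open>v\<close>
      alone and the window without it. Their independence turns the probability of
      \<open>B v K\<close> into a product.\<close>
    define I where "I b = (if b then {v} else {v - int K..v + int K} - {v})" for b
    define S where "S b = (if b then {f\<in>space (PiM (I b) (\<lambda>_. N)). f v \<in> G}
      else {f\<in>space (PiM (I b) (\<lambda>_. N)). \<forall>n\<in>{..K}. sparse_around W d n (\<lambda>w. f w) v})" for b
    let ?Y = "\<lambda>b \<omega>. restrict (\<lambda>i. X i \<omega>) (I b)"
    have ind: "indep_vars (\<lambda>b. PiM (I b) (\<lambda>_. N)) ?Y UNIV"
      by (rule indep_vars_restrict[OF X]) (auto simp: disjoint_family_on_def I_def)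
    have S_sets: "S b \<in> sets (PiM (I b) (\<lambda>_. N))" for b
    proof (cases b)
      case True
      have "(\<lambda>f. f v) \<in> measurable (PiM (I b) (\<lambda>_. N)) N"
        using True by (intro measurable_component_singleton) (simp add: I_def)
      then have "(\<lambda>f. f v) -` G \<inter> space (PiM (I b) (\<lambda>_. N)) \<in> sets (PiM (I b) (\<lambda>_. N))"
        using G by (rule measurable_sets)
      then show ?thesis using True by (simp add: S_def vimage_def Int_def conj_commute)
    next
      case False
      have "{f\<in>space (PiM (I b) (\<lambda>_. N)). sparse_around W d n (\<lambda>w. f w) v} \<in> sets (PiM (I b) (\<lambda>_. N))"
        if "n \<in> {..K}" for n
        using that False W
        by (intro sets_sparse_around measurable_component_singleton) (auto simp: I_def)
      then show ?thesis
        using False by (simp add: S_def sets.sets_Collect_finite_All)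
    qed
    have True_eq: "?Y True -` S True \<inter> space M = X v -` G \<inter> space M"
      using X_space by (auto simp: S_def I_def space_PiM)
    have "sparse_around W d n (restrict (\<lambda>i. X i \<omega>) (I False)) v \<longleftrightarrow> sparse_around W d n (\<lambda>i. X i \<omega>) v"
      if "n \<le> K" for n \<omega>
      using that by (intro sparse_around_cong) (auto simp: I_def)
    then have False_eq: "?Y False -` S False \<inter> space M = H v K"
      using X_space by (auto simp: S_def H_def space_PiM)
    have "prob (\<Inter>b\<in>UNIV. ?Y b -` S b \<inter> space M) = (\<Prod>b\<in>UNIV. prob (?Y b -` S b \<inter> space M))"
      using S_sets by (intro indep_varsD[OF ind]) auto
    then have "prob (H v K \<inter> (X v -` G \<inter> space M)) = prob (H v K) * prob (X v -` G \<inter> space M)"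
      by (simp add: UNIV_bool True_eq False_eq)
    then have "prob (B v K) = prob (X v -` G \<inter> space M) * prob (H v K)"
      unfolding B_def by (simp only: Int_commute mult.commute)
    then show ?thesis using mult_mono[OF g(1)[of v] H] g by simp
  qed
  define u where "u K j = int j * (2 * int K + 1)" for K j :: nat
  \<comment> \<open>Outside \<open>D K\<close>, one of the \<open>K + 1\<close> centres satisfies
    its truncated event, and no centre fails at a scale beyond \<open>K\<close>; that centre is then
    sparse at every scale. The numbers \<open>n + Suc K\<close> are exactly the scales beyond
    \<open>K\<close>.\<close>
  define D where "D K = (\<Inter>j\<in>{..K}. space M - B (u K j) K) \<union> (\<Union>j\<in>{..K}. \<Union>n. bad (u K j) (n + Suc K))" for K
  have H_sets: "H v K \<in> events" for v K
    unfolding H_def using X_meas W by (intro sets.sets_Collect_finite_All sets_sparse_around) auto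
  have B_sets: "B v K \<in> events" for v K
    unfolding B_def using H_sets X_meas G by (intro sets.Int measurable_sets) auto
  have D_sets: "D K \<in> events" for K
    unfolding D_def using B_sets bad_sets by (intro sets.Un sets.finite_INT sets.finite_UN sets.countable_UN) auto
  have no_B: "prob (\<Inter>j\<in>{..K}. space M - B (u K j) K) \<le> (1 - g / 3) ^ Suc K" for K
  proof -
    define I where "I j = {u K j - int K..u K j + int K}" for j
    let ?P = "\<lambda>j. PiM (I j) (\<lambda>_. N)"
    define S where "S j = {f\<in>space (?P j). f (u K j) \<in> G} \<inter>
      {f\<in>space (?P j). \<forall>n\<in>{..K}. sparse_around W d n (\<lambda>w. f w) (u K j)}" for j
    let ?Y = "\<lambda>j \<omega>. restrict (\<lambda>i. X i \<omega>) (I j)"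
    have "I i \<inter> I j = {}" if "i < j" for i j
    proof -
      have "(int i + 1) * (2 * int K + 1) \<le> int j * (2 * int K + 1)"
        using that by (intro mult_right_mono) auto
      then show ?thesis by (auto simp: I_def u_def algebra_simps)
    qed
    then have "disjoint_family_on I UNIV"
      by (metis disjoint_family_on_def inf_commute linorder_neqE_nat)
    then have ind: "indep_vars ?P ?Y UNIV"
      by (intro indep_vars_restrict[OF X]) auto
    have S_sets: "S j \<in> sets (?P j)" for j
      unfolding S_def
    proof (rule sets.Int)
      have "(\<lambda>f. f (u K j)) \<in> measurable (?P j) N"
        by (intro measurable_component_singleton) (simp add: I_def)
      then have "(\<lambda>f. f (u K j)) -` G \<inter> space (?P j) \<in> sets (?P j)"
        using G by (rule measurable_sets)
      then show "{f\<in>space (?P j). f (u K j) \<in> G} \<in> sets (?P j)"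
        by (simp add: vimage_def Int_def conj_commute)
      have "{f\<in>space (?P j). sparse_around W d n (\<lambda>w. f w) (u K j)} \<in> sets (?P j)"
        if "n \<in> {..K}" for n
        using that W by (intro sets_sparse_around measurable_component_singleton) (auto simp: I_def)
      then show "{f\<in>space (?P j). \<forall>n\<in>{..K}. sparse_around W d n (\<lambda>w. f w) (u K j)} \<in> sets (?P j)"
        by (intro sets.sets_Collect_finite_All) auto
    qed
    have "sparse_around W d n (restrict (\<lambda>i. X i \<omega>) (I j)) (u K j)
        \<longleftrightarrow> sparse_around W d n (\<lambda>i. X i \<omega>) (u K j)" if "n \<le> K" for n j \<omega>
      using that by (intro sparse_around_cong) (auto simp: I_def)
    then have "?Y j -` S j \<inter> space M = B (u K j) K" for j
      using X_space by (auto simp: S_def B_def H_def space_PiM I_def)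
    moreover have "?Y j \<omega> \<in> space (?P j)" if "\<omega> \<in> space M" for j \<omega>
      using X_space that by (auto simp: space_PiM)
    ultimately have compl: "?Y j -` (space (?P j) - S j) \<inter> space M = space M - B (u K j) K" for j
      by blast
    have "prob (\<Inter>j\<in>{..K}. ?Y j -` (space (?P j) - S j) \<inter> space M)
        = (\<Prod>j\<in>{..K}. prob (?Y j -` (space (?P j) - S j) \<inter> space M))"
      using S_sets by (intro indep_varsD[OF ind]) auto
    also have "\<dots> = (\<Prod>j\<in>{..K}. 1 - prob (B (u K j) K))"
      unfolding compl using B_sets by (simp add: prob_compl)
    also have "\<dots> \<le> (\<Prod>j\<in>{..K}. 1 - g / 3)"
      using B_ge by (intro prod_mono) auto
    finally show ?thesis unfolding compl by simp
  qed
  have tail: "prob (\<Union>n. bad v (n + Suc K)) \<le> (1 / 4) ^ K" for v K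
  proof -
    have sums: "(\<lambda>n. 2 * (1 / 4) ^ (n + Suc K)) sums (2 / 3 * (1 / 4 :: real) ^ K)"
      using sums_mult[OF geometric_sums[of "1 / 4 :: real"], of "2 * (1 / 4) ^ Suc K"]
      by (simp add: power_add mult_ac)
    have le: "prob (bad v (n + Suc K)) \<le> 2 * (1 / 4) ^ (n + Suc K)" for n
      by (intro bad_le) simp
    have summable: "summable (\<lambda>n. prob (bad v (n + Suc K)))"
      using le sums by (intro summable_comparison_test'[OF sums_summable]) auto
    have "prob (\<Union>n. bad v (n + Suc K)) \<le> (\<Sum>n. prob (bad v (n + Suc K)))"
      using bad_sets summable by (intro finite_measure_subadditive_countably) auto
    also have "\<dots> \<le> (\<Sum>n. 2 * (1 / 4) ^ (n + Suc K))"
      using le summable sums_summable[OF sums] by (intro suminf_le) auto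
    also have "\<dots> = 2 / 3 * (1 / 4) ^ K" using sums by (simp add: sums_iff)
    also have "\<dots> \<le> (1 / 4) ^ K" by simp
    finally show ?thesis .
  qed
  have "prob (D K) \<le> (1 - g / 3) ^ Suc K + real (Suc K) * (1 / 4) ^ K" for K
  proof -
    have sets: "(\<Inter>j\<in>{..K}. space M - B (u K j) K) \<in> events" "\<And>j. (\<Union>n. bad (u K j) (n + Suc K)) \<in> events"
      using B_sets bad_sets by (auto intro!: sets.finite_INT)
    have "prob (\<Union>j\<in>{..K}. \<Union>n. bad (u K j) (n + Suc K)) \<le> (\<Sum>j\<in>{..K}. prob (\<Union>n. bad (u K j) (n + Suc K)))"
      using sets by (intro measure_UNION_le) auto
    also have "\<dots> \<le> real (card {..K}) * (1 / 4) ^ K" using tail by (intro sum_bounded_above) auto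
    finally have "prob (\<Union>j\<in>{..K}. \<Union>n. bad (u K j) (n + Suc K)) \<le> real (Suc K) * (1 / 4) ^ K" by simp
    moreover have "prob (D K) \<le> prob (\<Inter>j\<in>{..K}. space M - B (u K j) K)
        + prob (\<Union>j\<in>{..K}. \<Union>n. bad (u K j) (n + Suc K))"
      unfolding D_def using sets by (intro measure_Un_le) auto
    ultimately show ?thesis using no_B[of K] by linarith
  qed
  moreover have "(\<lambda>K. (1 - g / 3) ^ Suc K + real (Suc K) * (1 / 4) ^ K) \<longlonglongrightarrow> 0"
  proof -
    \<comment> \<open>As a lower bound for a probability, \<open>g\<close> is at most 1, so
      \<open>1 - g / 3\<close> lies strictly between 0 and 1 and its powers vanish.\<close>
    have "g \<le> 1" using g(1)[of 0] prob_le_1[of "X 0 -` G \<inter> space M"] by linarith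
    then have "(\<lambda>K. (1 - g / 3) ^ Suc K) \<longlonglongrightarrow> 0"
      using g(2) by (intro LIMSEQ_Suc LIMSEQ_realpow_zero) auto
    moreover have "(\<lambda>K. real K * (1 / 4) ^ K + (1 / 4) ^ K) \<longlonglongrightarrow> 0 + 0"
      by (intro tendsto_add powser_times_n_limit_0 LIMSEQ_realpow_zero) auto
    then have "(\<lambda>K. real (Suc K) * (1 / 4) ^ K) \<longlonglongrightarrow> 0"
      by (simp add: algebra_simps)
    ultimately show ?thesis using tendsto_add by fastforce
  qed
  moreover have "\<exists>v. X v \<omega> \<in> G \<and> (\<forall>n. sparse_around W d n (\<lambda>w. X w \<omega>) v)"
    if "\<omega> \<in> space M" "\<omega> \<notin> D K" for \<omega> K
  proof -
    from that obtain j where j: "j \<le> K" "\<omega> \<in> B (u K j) K" by (auto simp: D_def)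
    have "sparse_around W d n (\<lambda>w. X w \<omega>) (u K j)" for n
    proof (cases "n \<le> K")
      case True
      then show ?thesis using j by (auto simp: B_def H_def)
    next
      case False
      then obtain m where "n = m + Suc K"
        by (metis add.commute less_iff_Suc_add not_le add_Suc_right)
      then show ?thesis using that j by (auto simp: D_def bad_def)
    qed
    then show ?thesis using j by (auto simp: B_def)
  qed
  ultimately show ?thesis using D_sets by (intro AE_I_small[of D]) auto
qed

end

subsection \<open>Poisson clocks\<close>

context prob_space
begin

lemma poisson_process_finite:
  assumes "poisson_process r E"
  shows "AE \<omega> in M. \<forall>t. finite (E \<omega> \<inter> {0<..t})"
  using assms by (auto simp: poisson_process_def)

text \<open>The event compares counts from time 0 because independence of the clocks is given for
  their counting processes. Almost surely the two counts differ iff the Poisson number of points in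
  between is nonzero.\<close>

lemma poisson_process_prob_points:
  assumes E: "poisson_process r E" and r: "0 < r" and ab: "0 \<le> a" "a < b"
  shows "prob {\<omega>\<in>space M. card (E \<omega> \<inter> {0<..b}) \<noteq> card (E \<omega> \<inter> {0<..a})} = 1 - exp (- (r * (b - a)))"
proof -
  have cnt: "(\<lambda>\<omega>. card (E \<omega> \<inter> {s<..t})) \<in> measurable M (count_space UNIV)" if "0 \<le> s" "s \<le> t" for s t
    using E that by (cases "s = t") (auto simp: poisson_process_def)
  let ?f = "\<lambda>\<omega>. card (E \<omega> \<inter> {a<..b})"
  have neq: "{\<omega>\<in>space M. f \<omega> \<noteq> g \<omega>} \<in> events"
    if "f \<in> measurable M (count_space UNIV)" "g \<in> measurable M (count_space UNIV)"
    for f g :: "'a \<Rightarrow> nat"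
  proof -
    have "{\<omega>\<in>space M. f \<omega> \<noteq> g \<omega>} = (\<Union>n. (f -` {n} \<inter> space M) - (g -` {n} \<inter> space M))" by auto
    also have "\<dots> \<in> events" using that by (intro sets.countable_UN) (auto intro: measurable_sets)
    finally show ?thesis .
  qed
  have cnt_0: "(\<lambda>\<omega>. card (E \<omega> \<inter> {0<..a})) \<in> measurable M (count_space UNIV)"
    "(\<lambda>\<omega>. card (E \<omega> \<inter> {0<..b})) \<in> measurable M (count_space UNIV)"
    using ab by (auto intro: cnt)
  have distr: "distr M (count_space UNIV) ?f = measure_pmf (poisson_pmf (r * (b - a)))"
    using E ab by (simp add: poisson_process_def)
  have "prob (?f -` {0} \<inter> space M) = measure (distr M (count_space UNIV) ?f) {0}"
    using ab cnt by (subst measure_distr) auto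
  also have "\<dots> = exp (- (r * (b - a)))"
    using r ab unfolding distr by (simp add: measure_pmf_single)
  finally have 0: "prob (?f -` {0} \<inter> space M) = exp (- (r * (b - a)))" .
  have "prob {\<omega>\<in>space M. card (E \<omega> \<inter> {0<..b}) \<noteq> card (E \<omega> \<inter> {0<..a})}
      = prob (space M - (?f -` {0} \<inter> space M))"
  proof (rule finite_measure_eq_AE)
    show "AE \<omega> in M. \<omega> \<in> {\<omega>\<in>space M. card (E \<omega> \<inter> {0<..b}) \<noteq> card (E \<omega> \<inter> {0<..a})}
        \<longleftrightarrow> \<omega> \<in> space M - (?f -` {0} \<inter> space M)"
      using poisson_process_finite[OF E]
    proof eventually_elim
      case (elim \<omega>)
      have "E \<omega> \<inter> {0<..b} = (E \<omega> \<inter> {0<..a}) \<union> (E \<omega> \<inter> {a<..b})" using ab by auto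
      moreover have "finite (E \<omega> \<inter> {a<..b})"
        by (rule finite_subset[of _ "E \<omega> \<inter> {0<..b}"]) (use elim ab in auto)
      \<comment> \<open>Infinite sets have \<open>card\<close> 0, so additivity relies on local
        finiteness and the two events agree only almost surely.\<close>
      ultimately have "card (E \<omega> \<inter> {0<..b}) = card (E \<omega> \<inter> {0<..a}) + card (E \<omega> \<inter> {a<..b})"
        using elim by (auto intro!: card_Un_disjoint)
      then show ?case by auto
    qed
    show "{\<omega>\<in>space M. card (E \<omega> \<inter> {0<..b}) \<noteq> card (E \<omega> \<inter> {0<..a})} \<in> events"
      using cnt_0 by (intro neq)
    show "space M - (?f -` {0} \<inter> space M) \<in> events"
      using ab by (intro sets.Diff measurable_sets[OF cnt]) auto
  qed
  also have "\<dots> = 1 - exp (- (r * (b - a)))"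
    using ab by (subst prob_compl) (auto simp: 0 intro!: measurable_sets[OF cnt])
  finally show ?thesis .
qed

context
  fixes r :: real and C :: "int \<Rightarrow> 'a \<Rightarrow> real set"
  assumes r: "0 < r" and poisson: "\<And>e. poisson_process r (C e)"
    and indep: "indep_vars (\<lambda>_. PiM UNIV (\<lambda>_. count_space UNIV)) (\<lambda>e \<omega> t. card (C e \<omega> \<inter> {0<..t})) UNIV"
begin

lemma clocks_locally_finite: "AE \<omega> in M. \<forall>e t. finite (C e \<omega> \<inter> {0<..t})"
  using poisson_process_finite[OF poisson] by (subst AE_all_countable) auto

definition all_ring :: "int set \<Rightarrow> real \<Rightarrow> real \<Rightarrow> 'a set" where
  "all_ring J a b = {\<omega>\<in>space M. \<forall>e\<in>J. card (C e \<omega> \<inter> {0<..b}) \<noteq> card (C e \<omega> \<inter> {0<..a})}"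

lemma all_ring:
  assumes J: "finite J" "J \<noteq> {}" and ab: "0 \<le> a" "a < b"
  shows "all_ring J a b \<in> events" "prob (all_ring J a b) = (1 - exp (- (r * (b - a)))) ^ card J"
proof -
  let ?N = "\<lambda>e \<omega> t. card (C e \<omega> \<inter> {0<..t})"
  let ?P = "PiM UNIV (\<lambda>_. count_space UNIV) :: (real \<Rightarrow> nat) measure"
  let ?A = "{g\<in>space ?P. g b \<noteq> g a}"
  have A: "?A \<in> sets ?P" by measurable
  have N: "?N e \<in> measurable M ?P" for e using indep by (auto simp: indep_vars_def)
  have eq: "all_ring J a b = (\<Inter>e\<in>J. ?N e -` ?A \<inter> space M)"
    using J by (auto simp: all_ring_def space_PiM)
  show "all_ring J a b \<in> events"
    unfolding eq using J A N by (intro sets.finite_INT measurable_sets) auto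
  have "?N e -` ?A \<inter> space M = {\<omega>\<in>space M. ?N e \<omega> b \<noteq> ?N e \<omega> a}" for e
    by (auto simp: space_PiM)
  then have "prob (?N e -` ?A \<inter> space M) = 1 - exp (- (r * (b - a)))" for e
    using poisson_process_prob_points[OF poisson r ab] by simp
  then show "prob (all_ring J a b) = (1 - exp (- (r * (b - a)))) ^ card J"
    unfolding eq using indep_varsD[OF indep J(2,1) _ A] by simp
qed

text \<open>By independence, the first \<open>k + 1\<close> edges of the enumeration all ring by
  time \<open>T\<close> with probability \<open>(1 - exp (- (r * T))) ^ (k + 1)\<close>, which tends
  to 0.\<close>

lemma AE_clock_gap:
  assumes \<sigma>: "inj \<sigma>" and T: "0 < T"
  shows "AE \<omega> in M. \<exists>i::nat. C (\<sigma> i) \<omega> \<inter> {0<..T} = {}"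
proof -
  let ?q = "1 - exp (- (r * T))"
  \<comment> \<open>Local finiteness enters as a premise because \<open>AE_I_small\<close> speaks of
    every outcome outside the exceptional event; with it, count zero means that there is no
    event.\<close>
  have "AE \<omega> in M. (\<forall>e t. finite (C e \<omega> \<inter> {0<..t})) \<longrightarrow> (\<exists>i::nat. C (\<sigma> i) \<omega> \<inter> {0<..T} = {})"
  proof (rule AE_I_small)
    show "all_ring (\<sigma> ` {..k}) 0 T \<in> events" for k using T by (intro all_ring) auto
    show "prob (all_ring (\<sigma> ` {..k}) 0 T) \<le> ?q ^ Suc k" for k
      using T all_ring(2)[of "\<sigma> ` {..k}" 0 T] card_image[OF inj_on_subset[OF \<sigma>], of "{..k}"] by simp
    show "(\<lambda>k. ?q ^ Suc k) \<longlonglongrightarrow> 0"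
      using r T by (intro LIMSEQ_Suc LIMSEQ_realpow_zero) auto
    show "(\<forall>e t. finite (C e \<omega> \<inter> {0<..t})) \<longrightarrow> (\<exists>i::nat. C (\<sigma> i) \<omega> \<inter> {0<..T} = {})"
      if "\<omega> \<in> space M" "\<omega> \<notin> all_ring (\<sigma> ` {..k}) 0 T" for k \<omega>
      using that by (auto simp: all_ring_def) blast
  qed
  with clocks_locally_finite show ?thesis by eventually_elim auto
qed

text \<open>Cut the time up to \<open>T\<close> into \<open>n + 1\<close> equal pieces. Both clocks
  ring in a given piece with probability at most \<open>(r * T / (n + 1)) ^ 2\<close>, hence in a
  common piece with probability at most \<open>(r * T) ^ 2 / (n + 1)\<close>. Under local
  finiteness, a simultaneous event would force a common piece for every \<open>n\<close>.\<close>

lemma AE_clocks_disjoint: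
  assumes ef: "e \<noteq> f" and T: "0 < T"
  shows "AE \<omega> in M. \<forall>t. 0 < t \<and> t \<le> T \<and> t \<in> C e \<omega> \<longrightarrow> t \<notin> C f \<omega>"
proof -
  let ?h = "\<lambda>n i. T * real i / real (Suc n)"
  let ?D = "\<lambda>n. \<Union>i\<in>{..n}. all_ring {e, f} (?h n i) (?h n (Suc i))"
  have h: "0 \<le> ?h n i" "?h n i < ?h n (Suc i)" "?h n (Suc i) - ?h n i = T / real (Suc n)" for n i
  proof -
    show "0 \<le> ?h n i" using T by simp
    show "?h n i < ?h n (Suc i)" using T by (intro divide_strict_right_mono mult_strict_left_mono) auto
    show "?h n (Suc i) - ?h n i = T / real (Suc n)"
      by (simp add: diff_divide_distrib[symmetric] right_diff_distrib[symmetric])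
  qed
  have ring: "all_ring {e, f} (?h n i) (?h n (Suc i)) \<in> events"
    "prob (all_ring {e, f} (?h n i) (?h n (Suc i))) \<le> (r * T / real (Suc n))\<^sup>2" for n i
  proof -
    show "all_ring {e, f} (?h n i) (?h n (Suc i)) \<in> events" using h by (intro all_ring) auto
    have "prob (all_ring {e, f} (?h n i) (?h n (Suc i))) = (1 - exp (- (r * T / real (Suc n))))\<^sup>2"
      using ef h(3)[of i n] all_ring(2)[OF _ _ h(1,2)[of i n], of "{e, f}"] by (simp add: power2_eq_square)
    also have "\<dots> \<le> (r * T / real (Suc n))\<^sup>2"
    proof (rule power_mono)
      show "1 - exp (- (r * T / real (Suc n))) \<le> r * T / real (Suc n)"
        using exp_ge_add_one_self[of "- (r * T / real (Suc n))"] by linarith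
      show "0 \<le> 1 - exp (- (r * T / real (Suc n)))" using r T by simp
    qed
    finally show "prob (all_ring {e, f} (?h n i) (?h n (Suc i))) \<le> (r * T / real (Suc n))\<^sup>2" .
  qed
  have "AE \<omega> in M. (\<forall>e t. finite (C e \<omega> \<inter> {0<..t})) \<longrightarrow>
      (\<forall>t. 0 < t \<and> t \<le> T \<and> t \<in> C e \<omega> \<longrightarrow> t \<notin> C f \<omega>)"
  proof (rule AE_I_small)
    show "?D n \<in> events" for n using ring by auto
    show "prob (?D n) \<le> (r * T)\<^sup>2 / real (Suc n)" for n
    proof -
      have "prob (?D n) \<le> (\<Sum>i\<in>{..n}. prob (all_ring {e, f} (?h n i) (?h n (Suc i))))"
        using ring by (intro measure_UNION_le) auto
      also have "\<dots> \<le> real (card {..n}) * (r * T / real (Suc n))\<^sup>2"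
        using ring by (intro sum_bounded_above) auto
      also have "\<dots> = (r * T)\<^sup>2 / real (Suc n)" by (simp add: power2_eq_square)
      finally show ?thesis .
    qed
    show "(\<lambda>n. (r * T)\<^sup>2 / real (Suc n)) \<longlonglongrightarrow> 0"
      by (rule LIMSEQ_Suc[OF lim_const_over_n])
    show "(\<forall>e t. finite (C e \<omega> \<inter> {0<..t})) \<longrightarrow>
        (\<forall>t. 0 < t \<and> t \<le> T \<and> t \<in> C e \<omega> \<longrightarrow> t \<notin> C f \<omega>)"
      if \<omega>: "\<omega> \<in> space M" "\<omega> \<notin> ?D n" for n \<omega>
    proof (intro impI allI notI)
      fix t assume fin: "\<forall>e t. finite (C e \<omega> \<inter> {0<..t})"
        and t: "0 < t \<and> t \<le> T \<and> t \<in> C e \<omega>" and tf: "t \<in> C f \<omega>"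
      \<comment> \<open>The pieces are open on the left and closed on the right, so the one
        containing \<open>t\<close> has index ceiling minus one.\<close>
      define i where "i = nat (\<lceil>t * real (Suc n) / T\<rceil> - 1)"
      define z where "z = t * real (Suc n) / T"
      have "0 < z" using t T by (simp add: z_def)
      moreover have "z \<le> real (Suc n)"
        unfolding z_def using t T by (subst pos_divide_le_eq) (auto simp: mult.commute intro!: mult_right_mono)
      ultimately have z: "0 < z" "z \<le> real (Suc n)" by auto
      have i: "real i < z" "z \<le> real (Suc i)" "i \<le> n"
        using z unfolding i_def z_def[symmetric] by linarith+
      have tz: "t = T * z / real (Suc n)" using T by (simp add: z_def)
      have "?h n i < t" "t \<le> ?h n (Suc i)"
        unfolding tz using i T by (auto intro!: divide_strict_right_mono divide_right_mono)
      then have "card (C g \<omega> \<inter> {0<..?h n i}) < card (C g \<omega> \<inter> {0<..?h n (Suc i)})"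
        if "t \<in> C g \<omega>" for g
      proof (intro psubset_card_mono)
        show "finite (C g \<omega> \<inter> {0<..?h n (Suc i)})" using fin by blast
        assume t': "?h n i < t" "t \<le> ?h n (Suc i)"
        have "t \<in> C g \<omega> \<inter> {0<..?h n (Suc i)}" "t \<notin> C g \<omega> \<inter> {0<..?h n i}"
          using that t t' by auto
        moreover have "C g \<omega> \<inter> {0<..?h n i} \<subseteq> C g \<omega> \<inter> {0<..?h n (Suc i)}"
          using t' by auto
        ultimately show "C g \<omega> \<inter> {0<..?h n i} \<subset> C g \<omega> \<inter> {0<..?h n (Suc i)}" by blast
      qed
      then have "\<omega> \<in> all_ring {e, f} (?h n i) (?h n (Suc i))"
        using \<omega>(1) t tf unfolding all_ring_def by fastforce
      then show False using \<omega>(2) i by blast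
    qed
  qed
  with clocks_locally_finite show ?thesis by eventually_elim auto
qed

end

end

subsection \<open>Triangular opinions\<close>

lemma borel_measurable_triangular_density [measurable]: "triangular_density u \<in> borel_measurable borel"
  by (cases u) (simp add: triangular_density_def)

lemma triangular_density_measurable_unit [measurable]:
  "triangular_density u \<in> borel_measurable unit_lborel"
  by (intro measurable_restrict_space1) simp

lemma triangular_density_le:
  assumes "0 < s" "s \<le> \<bar>y - z\<bar>"
  shows "triangular_density (y, z) x \<le> 2 / s"
proof -
  have "triangular_density (y, z) x \<le> 2 / \<bar>y - z\<bar> * 1"
    unfolding triangular_density_def case_prod_conv
    by (intro mult_left_mono) auto
  also have "\<dots> \<le> 2 / s" using assms by (simp add: frac_le)
  finally show ?thesis .
qed

lemma triangular_density_outside: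
  assumes "y < z" "x \<notin> {y..z}"
  shows "triangular_density (y, z) x = 0"
proof -
  have "(z - y) / 2 \<le> \<bar>x - (y + z) / 2\<bar>" using assms by (auto simp: abs_if field_simps)
  then have "1 \<le> 2 / \<bar>y - z\<bar> * \<bar>x - (y + z) / 2\<bar>" using assms by (simp add: field_simps)
  then show ?thesis by (simp add: triangular_density_def)
qed

text \<open>A triangle of base at least \<open>s\<close> has height at most \<open>2 / s\<close>, so
  wide triangles put little mass on a short interval.\<close>

lemma measure_triangular_opinion_le:
  assumes s: "0 < s" "s \<le> \<bar>y - z\<bar>" and ab: "0 \<le> a" "a \<le> b" "b \<le> 1"
  shows "measure (triangular_opinion (y, z)) {a..b} \<le> 2 / s * (b - a)"
proof -
  have A: "{a..b} \<in> sets unit_lborel" using ab by (simp add: sets_restrict_space_iff)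
  have "emeasure (triangular_opinion (y, z)) {a..b}
      = (\<integral>\<^sup>+x. ennreal (triangular_density (y, z) x) * indicator {a..b} x \<partial>unit_lborel)"
    unfolding triangular_opinion_def using A by (intro emeasure_density) auto
  also have "\<dots> \<le> (\<integral>\<^sup>+x. ennreal (2 / s) * indicator {a..b} x \<partial>unit_lborel)"
    using triangular_density_le[OF s] by (intro nn_integral_mono mult_right_mono ennreal_leI) auto
  also have "\<dots> = ennreal (2 / s) * emeasure unit_lborel {a..b}"
    using A by (simp add: nn_integral_cmult_indicator)
  also have "\<dots> = ennreal (2 / s * (b - a))"
    using ab s by (simp add: emeasure_restrict_space ennreal_mult del: times_divide_eq_left)
  finally show ?thesis
    using s ab unfolding measure_def by (intro enn2real_leI) auto
qed

text \<open>Total mass one is taken from \<open>op\<close> instead of integrating the density; the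
  complement of the interval is null because the density vanishes outside
  \<open>{y..z}\<close>.\<close>

lemma measure_triangular_opinion_eq_1:
  assumes op: "opinion (triangular_opinion (y, z))"
    and yz: "a \<le> y" "y < z" "z \<le> b" and ab: "0 \<le> a" "b \<le> 1"
  shows "measure (triangular_opinion (y, z)) {a..b} = 1"
proof -
  interpret prob_space "triangular_opinion (y, z)" using op by (simp add: opinion_def)
  have sets: "sets (triangular_opinion (y, z)) = sets unit_lborel"
    by (simp add: triangular_opinion_def)
  have A: "{a..b} \<in> sets unit_lborel" using yz ab by (simp add: sets_restrict_space_iff)
  let ?B = "space unit_lborel - {a..b}"
  have B: "?B \<in> sets unit_lborel" using A by (rule sets.compl_sets)
  have "emeasure (triangular_opinion (y, z)) ?B
      = (\<integral>\<^sup>+x. ennreal (triangular_density (y, z) x) * indicator ?B x \<partial>unit_lborel)"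
    unfolding triangular_opinion_def using B by (intro emeasure_density) auto
  also have "\<dots> = (\<integral>\<^sup>+x. 0 \<partial>unit_lborel)"
  proof (rule nn_integral_cong)
    fix x
    show "ennreal (triangular_density (y, z) x) * indicator ?B x = 0"
      using triangular_density_outside[OF yz(2), of x] yz by (cases "x \<in> {y..z}") auto
  qed
  finally have "prob (space (triangular_opinion (y, z)) - {a..b}) = 0"
    by (simp add: measure_def triangular_opinion_def)
  then show ?thesis using prob_compl[of "{a..b}"] A sets by simp
qed

section \<open>The uniform distribution on the unit square\<close>

lemma emeasure_uniform_unit_square:
  assumes "A \<in> sets (borel :: (real \<times> real) measure)"
  shows "emeasure (uniform_measure lborel ({0..1} \<times> {0..1})) A
    = emeasure (lborel \<Otimes>\<^sub>M lborel) (({0..1} \<times> {0..1}) \<inter> A :: (real \<times> real) set)"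
proof -
  have sq: "{0..1::real} \<times> {0..1::real} \<in> sets borel"
    by (intro borel_closed closed_Times) auto
  have "emeasure (lborel \<Otimes>\<^sub>M lborel) ({0..1::real} \<times> {0..1::real}) = 1"
    by (subst lborel.emeasure_pair_measure_Times) auto
  then show ?thesis
    using assms sq by (simp add: lborel_prod divide_ennreal_def)
qed

text \<open>Every vertical section of the strip lies in an interval of length \<open>2 * s\<close>;
  integrate over the first coordinate.\<close>

lemma emeasure_uniform_strip_le:
  assumes "0 < s"
  shows "emeasure (uniform_measure lborel ({0..1} \<times> {0..1})) {u::real \<times> real. \<bar>fst u - snd u\<bar> < s}
    \<le> ennreal (2 * s)"
proof -
  let ?W = "{u::real \<times> real. \<bar>fst u - snd u\<bar> < s}"
  have W: "?W \<in> sets borel" by (intro borel_open open_Collect_less continuous_intros)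
  have "({0..1} \<times> {0..1}) \<inter> ?W \<in> sets (lborel \<Otimes>\<^sub>M lborel)"
    using W unfolding lborel_prod sets_lborel by (intro sets.Int[OF borel_closed] closed_Times) auto
  then have "emeasure (lborel \<Otimes>\<^sub>M lborel) (({0..1} \<times> {0..1}) \<inter> ?W)
      = (\<integral>\<^sup>+x. emeasure lborel (Pair x -` (({0..1} \<times> {0..1}) \<inter> ?W)) \<partial>lborel)"
    by (rule lborel.emeasure_pair_measure_alt)
  also have "\<dots> \<le> (\<integral>\<^sup>+(x::real). ennreal (2 * s) * indicator {0..1} x \<partial>lborel)"
  proof (rule nn_integral_mono)
    fix x :: real
    show "emeasure lborel (Pair x -` (({0..1} \<times> {0..1}) \<inter> ?W)) \<le> ennreal (2 * s) * indicator {0..1} x"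
    proof (cases "x \<in> {0..1}")
      case True
      have "emeasure lborel (Pair x -` (({0..1} \<times> {0..1}) \<inter> ?W)) \<le> emeasure lborel {x - s..x + s}"
        by (intro emeasure_mono) auto
      then show ?thesis using True assms by simp
    next
      case False
      then have "Pair x -` (({0..1} \<times> {0..1}) \<inter> ?W) = {}" by auto
      then show ?thesis by simp
    qed
  qed
  also have "\<dots> = ennreal (2 * s)" by (simp add: nn_integral_cmult_indicator)
  finally show ?thesis using W by (simp add: emeasure_uniform_unit_square)
qed

lemma emeasure_uniform_rectangle:
  assumes "0 < \<epsilon>" "\<epsilon> \<le> 1 / 2"
  shows "emeasure (uniform_measure lborel ({0..1} \<times> {0..1}))
    ({1 / 2 - \<epsilon>..<1 / 2} \<times> {1 / 2..1 / 2 + \<epsilon>} :: (real \<times> real) set) = ennreal (\<epsilon>\<^sup>2)"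
proof -
  have "({0..1} \<times> {0..1}) \<inter> ({1 / 2 - \<epsilon>..<1 / 2} \<times> {1 / 2..1 / 2 + \<epsilon>})
      = {1 / 2 - \<epsilon>..<1 / 2} \<times> {1 / 2..1 / 2 + \<epsilon>}"
    using assms by auto
  then show ?thesis
    using assms
    by (subst emeasure_uniform_unit_square)
      (auto simp: lborel.emeasure_pair_measure_Times power2_eq_square ennreal_mult borel_Times)
qed

subsection \<open>Almost sure disagreement\<close>

theorem theorem3p1:
  fixes M :: "'w measure"
    and \<theta> \<mu> r :: real
    and C :: "int \<Rightarrow> 'w \<Rightarrow> real set"
    and \<eta> :: "real \<Rightarrow> int \<Rightarrow> 'w \<Rightarrow> real measure"
    and U :: "int \<Rightarrow> 'w \<Rightarrow> real \<times> real"
  assumes model: "deffuant_model M \<theta> \<mu> r C \<eta>"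
    and U_indep: "prob_space.indep_vars M (\<lambda>_. borel) U UNIV"
    and U_uniform: "\<And>v. distr M borel (U v) = uniform_measure lborel ({0..1} \<times> {0..1})"
    and initial: "\<And>v. AE \<omega> in M. \<eta> 0 v \<omega> = triangular_opinion (U v \<omega>)"
    and theta: "0 \<le> \<theta>" "\<theta> < 1"
  shows "AE \<omega> in M. \<exists>u::int. \<exists>T\<ge>0. \<forall>t\<ge>T. tv_dist (\<eta> t u \<omega>) (\<eta> t (u + 1) \<omega>) > \<theta>"
proof -
  interpret deffuant_model M \<theta> \<mu> r C \<eta> by fact
  \<comment> \<open>The average masses will be bounded by \<open>2 * d\<close>: one \<open>d\<close>
    for the fraction of narrow triangles, one for the mass that a wide triangle puts on
    \<open>A\<close>. The divisor 3 keeps \<open>2 * d\<close> below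
    \<open>1 - \<theta>\<close>.\<close>
  define d where "d = (1 - \<theta>) / 3"
  have d: "0 < d" using theta by (simp add: d_def)
  \<comment> \<open>Solves \<open>p powr d = 1 / 8\<close>, so that
    \<open>2 * p powr d = 1 / 4\<close>.\<close>
  define p where "p = (1 / 8) powr (1 / d)"
  have p: "0 < p" "p < 1" "2 * p powr d \<le> 1 / 4"
  proof -
    have "(1 / 8) powr (1 / d) < (1 :: real) powr (1 / d)"
      using d by (intro powr_less_mono2) auto
    then show "p < 1" by (simp add: p_def)
    show "0 < p" by (simp add: p_def)
    show "2 * p powr d \<le> 1 / 4" using d by (simp add: p_def powr_powr)
  qed
  \<comment> \<open>Triangles with base shorter than \<open>s\<close> then have probability at most
    \<open>2 * s = p\<close>.\<close>
  define s where "s = p / 2"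
  have s: "0 < s" using p by (simp add: s_def)
  \<comment> \<open>\<open>A\<close> has length \<open>2 * \<epsilon>\<close>, so a triangle of base
    at least \<open>s\<close> gives it mass at most \<open>4 * \<epsilon> / s\<close>, hence at most
    \<open>d\<close>. The cap \<open>1 / 2\<close> keeps \<open>A\<close> inside the unit
    interval.\<close>
  define \<epsilon> where "\<epsilon> = min (1 / 2) (d * s / 4)"
  have \<epsilon>: "0 < \<epsilon>" "\<epsilon> \<le> 1 / 2" "\<epsilon> \<le> d * s / 4" using d s by (auto simp: \<epsilon>_def)
  define A where "A = {1 / 2 - \<epsilon>..1 / 2 + \<epsilon>}"
  define W where "W = {u::real \<times> real. \<bar>fst u - snd u\<bar> < s}"
  \<comment> \<open>The half-open side forces \<open>y < z\<close>, so parameters in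
    \<open>G\<close> give nondegenerate triangles supported in \<open>A\<close>.\<close>
  define G where "G = {1 / 2 - \<epsilon>..<1 / 2} \<times> {1 / 2..1 / 2 + \<epsilon>}"
  have W: "W \<in> sets borel" unfolding W_def by (intro borel_open open_Collect_less continuous_intros)
  have G: "G \<in> sets borel" unfolding G_def by (intro borel_Times) auto
  have U: "U v \<in> measurable M borel" for v using U_indep by (auto simp: indep_vars_def)
  have U_prob: "emeasure M (U v -` S \<inter> space M) = emeasure (uniform_measure lborel ({0..1} \<times> {0..1})) S"
    if "S \<in> sets borel" for v S
    using emeasure_distr[OF U that, of v] unfolding U_uniform by simp
  have W_prob: "prob (U v -` W \<inter> space M) \<le> p" for v
  proof -
    have "ennreal (prob (U v -` W \<inter> space M)) \<le> ennreal (2 * s)"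
      using emeasure_uniform_strip_le[OF s] U_prob[OF W, of v]
      by (simp add: W_def[symmetric] emeasure_eq_measure)
    then show ?thesis using p s by (simp add: s_def)
  qed
  have G_prob: "\<epsilon>\<^sup>2 \<le> prob (U v -` G \<inter> space M)" for v
    using emeasure_uniform_rectangle[OF \<epsilon>(1,2)] U_prob[OF G, of v]
    by (simp add: G_def[symmetric] emeasure_eq_measure)
  have "0 < \<epsilon>\<^sup>2" using \<epsilon> by simp
  note sparse = AE_exists_sparse_around[OF U_indep W G W_prob p(1,2) d p(3) G_prob this]
  have init: "AE \<omega> in M. \<forall>v. \<eta> 0 v \<omega> = triangular_opinion (U v \<omega>)"
    using initial by (subst AE_all_countable) auto
  note clocks = rate_pos clocks_poisson clocks_indep
  \<comment> \<open>The horizons \<open>Suc n\<close> are countably many, so the null sets can be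
    united, and positive, as \<open>AE_clocks_disjoint\<close> requires.\<close>
  have disj: "AE \<omega> in M. \<forall>e f n. e \<noteq> f \<longrightarrow>
      (\<forall>t. 0 < t \<and> t \<le> real (Suc n) \<and> t \<in> C e \<omega> \<longrightarrow> t \<notin> C f \<omega>)"
    unfolding AE_all_countable using AE_clocks_disjoint[OF clocks] by auto
  have gap_right: "AE \<omega> in M. \<forall>w n. \<exists>i. C (w + int i) \<omega> \<inter> {0<..real (Suc n)} = {}"
    unfolding AE_all_countable by (intro allI AE_clock_gap[OF clocks]) (auto simp: inj_def)
  have gap_left: "AE \<omega> in M. \<forall>w n. \<exists>i. C (w - int i) \<omega> \<inter> {0<..real (Suc n)} = {}"
    unfolding AE_all_countable by (intro allI AE_clock_gap[OF clocks]) (auto simp: inj_def)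
  show ?thesis
    using sparse init disj gap_right gap_left clocks_locally_finite[OF clocks] dynamics
  proof eventually_elim
    case (elim \<omega>)
    note path = elim(7)
    from elim(1) obtain v where v: "U v \<omega> \<in> G" "\<And>n. sparse_around W d n (\<lambda>w. U w \<omega>) v" by blast
    have op: "opinion (triangular_opinion (U w \<omega>))" for w
      using deffuant_path_opinion[OF path order_refl, of w] elim(2) by simp
    have centre: "measure (\<eta> 0 v \<omega>) A = 1"
      using v(1) op[of v] elim(2) \<epsilon> unfolding A_def
      by (cases "U v \<omega>") (auto simp: G_def intro!: measure_triangular_opinion_eq_1)
    \<comment> \<open>A narrow triangle may put mass up to 1 on \<open>A\<close>; a wide one puts at
      most \<open>d\<close> there.\<close>
    have bound: "measure (\<eta> 0 w \<omega>) A \<le> indicator W (U w \<omega>) + d" for w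
    proof (cases "U w \<omega> \<in> W")
      case True
      interpret a: prob_space "triangular_opinion (U w \<omega>)" using op by (simp add: opinion_def)
      have "measure (\<eta> 0 w \<omega>) A \<le> 1" using a.prob_le_1[of A] elim(2) by simp
      then show ?thesis using True d by simp
    next
      case False
      then have "measure (\<eta> 0 w \<omega>) A \<le> 2 / s * (1 / 2 + \<epsilon> - (1 / 2 - \<epsilon>))"
        using measure_triangular_opinion_le[OF s, of "fst (U w \<omega>)" "snd (U w \<omega>)" "1 / 2 - \<epsilon>" "1 / 2 + \<epsilon>"]
          elim(2) \<epsilon> unfolding A_def W_def by simp
      also have "\<dots> = 4 / s * \<epsilon>" by simp
      also have "\<dots> \<le> 4 / s * (d * s / 4)" using \<epsilon> s by (intro mult_left_mono) auto
      finally show ?thesis using False s by simp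
    qed
    have sums: "(\<Sum>k<n. measure (\<eta> 0 (\<sigma> k) \<omega>) A) \<le> 2 * d * real n"
      if "real (card {k. k < n \<and> U (\<sigma> k) \<omega> \<in> W}) \<le> d * real n" for \<sigma> :: "nat \<Rightarrow> int" and n
    proof -
      have "(\<Sum>k<n. measure (\<eta> 0 (\<sigma> k) \<omega>) A) \<le> (\<Sum>k<n. indicator W (U (\<sigma> k) \<omega>) + d)"
        by (intro sum_mono bound)
      also have "\<dots> = real (card {k. k < n \<and> U (\<sigma> k) \<omega> \<in> W}) + d * real n"
        by (simp add: sum.distrib real_card_eq_sum_indicator)
      finally show ?thesis using that by linarith
    qed
    \<comment> \<open>The edge from \<open>v\<close> to \<open>v + 1\<close> exceeds the confidence
      bound from the start, so \<open>T = 0\<close> is the witness.\<close>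
    have "\<theta> < tv_dist (\<eta> t v \<omega>) (\<eta> t (v + 1) \<omega>)" if t: "0 \<le> t" for t
    proof (rule deffuant_path_frozen[OF path _ _ _ _ _ _ _ _ centre _ _ t])
      show "0 \<le> \<mu>" "\<mu> \<le> 1 / 2" using convergence_parameter by auto
      show "finite (C e \<omega> \<inter> {0<..u})" for e u using elim(6) by blast
      show "u \<notin> C f \<omega>" if "e \<noteq> f" "0 < u" "u \<in> C e \<omega>" for e f u
      proof -
        obtain n where "u \<le> real n" using real_arch_simple by blast
        then have "u \<le> real (Suc n)" by simp
        then show ?thesis using elim(3) that by blast
      qed
      show "\<exists>e\<ge>w. C e \<omega> \<inter> {0<..real n} = {}" for w n
      proof -
        obtain i where "C (w + int i) \<omega> \<inter> {0<..real (Suc n)} = {}" using elim(4) by blast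
        moreover have "{0<..real n} \<subseteq> {0<..real (Suc n)}" by auto
        ultimately show ?thesis by (intro exI[of _ "w + int i"]) auto
      qed
      show "\<exists>e\<le>w. C e \<omega> \<inter> {0<..real n} = {}" for w n
      proof -
        obtain i where "C (w - int i) \<omega> \<inter> {0<..real (Suc n)} = {}" using elim(5) by blast
        moreover have "{0<..real n} \<subseteq> {0<..real (Suc n)}" by auto
        ultimately show ?thesis by (intro exI[of _ "w - int i"]) auto
      qed
      show "A \<in> sets unit_lborel" using \<epsilon> by (simp add: A_def sets_restrict_space_iff)
      show "2 * d < 1 - \<theta>" using theta by (simp add: d_def)
      show "(\<Sum>k<n. measure (\<eta> 0 (v + 1 + int k) \<omega>) A) \<le> 2 * d * real n" for n
        using v(2)[of n] by (intro sums) (simp add: sparse_around_def)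
      show "(\<Sum>k<n. measure (\<eta> 0 (v - 1 - int k) \<omega>) A) \<le> 2 * d * real n" for n
        using v(2)[of n] by (intro sums) (simp add: sparse_around_def)
    qed
    then show ?case by blast
  qed
qed

end
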